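(* Let $d\ge 1$, $k\ge 1$, and let $\mathbf{\Lambda}_j=(\lambda_{j1},\lambda_{j2},\dots,\lambda_{jd})\succ\mathbf{0}$, $j=1,2,\dots,k$, be vectors in $\mathbb{R}^d_+$. Let $\{\mathscr{N}_1(\mathbf{t})\}_{\mathbf{t}\in\mathbb{R}_+^d}$, $\{\mathscr{N}_2(\mathbf{t})\}_{\mathbf{t}\in\mathbb{R}_+^d}$, $\dots$, $\{\mathscr{N}_k(\mathbf{t})\}_{\mathbf{t}\in\mathbb{R}_+^d}$ be independent multiparameter counting processes. Then the following are equivalent: (a) for every $l$ with $1\le l\le k$, the weighted process $$\mathscr{M}(\mathbf{t})=\mathscr{N}_1(\mathbf{t})+2\mathscr{N}_2(\mathbf{t})+\dots+l\,\mathscr{N}_l(\mathbf{t}),\quad \mathbf{t}\in\mathbb{R}^d_+,$$ is a multiparameter GCP with transition parameters $\mathbf{\Lambda}_j$, $j=1,2,\dots,l$; (b) for each $j=1,2,\dots,k$, $\{\mathscr{N}_j(\mathbf{t})\}_{\mathbf{t}\in\mathbb{R}_+^d}$ is a multiparameter Poisson process with transition parameter $\mathbf{\Lambda}_j$.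
   Context: $\mathbb{R}_+=[0,\infty)$, $\mathbb{N}_0=\{0,1,2,\dots\}$, $\mathbf{0}$ is the zero vector of $\mathbb{R}^d_+$, and $\mathbf{t}\cdot\mathbf{s}=\sum_{i=1}^d t_is_i$. For $\mathbf{s},\mathbf{t}\in\mathbb{R}^d_+$, $\mathbf{s}\preceq\mathbf{t}$ means $s_i\le t_i$ for all $i$, and $\mathbf{s}\prec\mathbf{t}$ (equivalently $\mathbf{t}\succ\mathbf{s}$) means $s_i<t_i$ for all $i$. $\overset{d}{=}$ denotes equality in distribution. An integer-valued random process $\{\mathcal{N}(\mathbf{t})\}_{\mathbf{t}\in\mathbb{R}^d_+}$ is a multiparameter counting process if $\mathcal{N}(\mathbf{0})=0$, $\mathcal{N}(\mathbf{t})\ge0$ for all $\mathbf{t}$, and $\mathcal{N}(\mathbf{s})\le\mathcal{N}(\mathbf{t})$ whenever $\mathbf{s}\preceq\mathbf{t}$. For $m\ge 1$ and vectors $\mathbf{\Lambda}_1,\dots,\mathbf{\Lambda}_m\succ\mathbf{0}$, a multiparameter counting process $\{\mathscr{M}(\mathbf{t})\}_{\mathbf{t}\in\mathbb{R}^d_+}$ is a multiparameter GCP (generalized counting process) with transition parameters (rates) $\mathbf{\Lambda}_j$, $j=1,\dots,m$, if: (i) $\mathscr{M}(\mathbf{0})=0$; (ii) it has independent increments: whenever $\mathbf{0}=\mathbf{t}^{(0)}\prec\mathbf{t}^{(1)}\prec\dots\prec\mathbf{t}^{(n)}$, the increments $\mathscr{M}(\mathbf{t}^{(1)})-\mathscr{M}(\mathbf{t}^{(0)}),\dots,\mathscr{M}(\mathbf{t}^{(n)})-\mathscr{M}(\mathbf{t}^{(n-1)})$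 are mutually independent; (iii) it has stationary increments: $\mathscr{M}(\mathbf{t})-\mathscr{M}(\mathbf{s})\overset{d}{=}\mathscr{M}(\mathbf{t}-\mathbf{s})$ whenever $\mathbf{s}\preceq\mathbf{t}$; (iv) for every $\mathbf{t}\in\mathbb{R}^d_+$ and $n\ge0$, $$\mathrm{Pr}(\mathscr{M}(\mathbf{t})=n)=\sum_{\Omega(m,n)}\prod_{j=1}^{m}\frac{(\mathbf{\Lambda}_j\cdot\mathbf{t})^{x_j}}{x_j!}e^{-\mathbf{\Lambda}_j\cdot\mathbf{t}},$$ where $\Omega(m,n)=\{(x_1,\dots,x_m):\sum_{j=1}^m jx_j=n,\ x_j\in\mathbb{N}_0\}$. A multiparameter Poisson process with transition parameter $\mathbf{\Lambda}\succ\mathbf{0}$ is a multiparameter counting process which starts at $0$ at $\mathbf{t}=\mathbf{0}$, has independent and stationary increments in the sense of (ii) and (iii), and is such that $\mathscr{N}(\mathbf{t})$ has the Poisson distribution with mean $\mathbf{\Lambda}\cdot\mathbf{t}$ for every $\mathbf{t}$ (i.e. the case $m=1$ above). *)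

theory Defs
  imports "HOL-Probability.Probability"
begin

text \<open>
  Time points are vectors of \<open>real ^ 'd\<close>, so that the dimension is \<open>CARD('d)\<close>. A process
  is a function on all of \<open>real ^ 'd\<close>, of which only the values on the orthant
  \<open>{0..}\<close> matter. On \<open>real ^ 'd\<close> the library's \<open>\<le>\<close> is componentwise, but its \<open><\<close> only
  says \<open>s \<le> t \<and> s \<noteq> t\<close>; strict inequality in every component is the following relation.
\<close>

definition strictly_below :: "real ^ 'd \<Rightarrow> real ^ 'd \<Rightarrow> bool"  (infix \<open>\<prec>\<close> 50)
  where "s \<prec> t \<longleftrightarrow> (\<forall>i. s $ i < t $ i)"

definition multiparameter_counting_process ::
    "'w measure \<Rightarrow> (real ^ 'd \<Rightarrow> 'w \<Rightarrow> int) \<Rightarrow> bool"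
  where "multiparameter_counting_process P X \<longleftrightarrow>
    (\<forall>t\<ge>0. X t \<in> measurable P (count_space UNIV)) \<and>
    (\<forall>\<omega>\<in>space P. X 0 \<omega> = 0) \<and>
    (\<forall>t\<ge>0. \<forall>\<omega>\<in>space P. 0 \<le> X t \<omega>) \<and>
    (\<forall>s\<ge>0. \<forall>t\<ge>s. \<forall>\<omega>\<in>space P. X s \<omega> \<le> X t \<omega>)"

definition independent_increments ::
    "'w measure \<Rightarrow> (real ^ 'd \<Rightarrow> 'w \<Rightarrow> int) \<Rightarrow> bool"
  where "independent_increments P X \<longleftrightarrow>
    (\<forall>(n::nat) t. t 0 = 0 \<longrightarrow> (\<forall>i<n. t i \<prec> t (Suc i)) \<longrightarrow>
       prob_space.indep_vars P (\<lambda>_. count_space UNIV)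
         (\<lambda>i \<omega>. X (t (Suc i)) \<omega> - X (t i) \<omega>) {..<n})"

definition stationary_increments ::
    "'w measure \<Rightarrow> (real ^ 'd \<Rightarrow> 'w \<Rightarrow> int) \<Rightarrow> bool"
  where "stationary_increments P X \<longleftrightarrow>
    (\<forall>s\<ge>0. \<forall>t\<ge>s.
       distr P (count_space UNIV) (\<lambda>\<omega>. X t \<omega> - X s \<omega>) =
       distr P (count_space UNIV) (X (t - s)))"

text \<open>
  Tuples \<open>(x\<^sub>1, \<dots>, x\<^sub>m)\<close> are extensional functions on \<open>{1..m}\<close>, so that each of them is counted
  exactly once; the set is finite.
\<close>

definition gcp_index_set :: "nat \<Rightarrow> nat \<Rightarrow> (nat \<Rightarrow> nat) set"
  where "gcp_index_set m n = {x \<in> {1..m} \<rightarrow>\<^sub>E UNIV. (\<Sum>j=1..m. j * x j) = n}"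

definition multiparameter_GCP ::
    "'w measure \<Rightarrow> nat \<Rightarrow> (nat \<Rightarrow> real ^ 'd) \<Rightarrow> (real ^ 'd \<Rightarrow> 'w \<Rightarrow> int) \<Rightarrow> bool"
  where "multiparameter_GCP P m \<Lambda> X \<longleftrightarrow>
    m \<ge> 1 \<and> (\<forall>j\<in>{1..m}. 0 \<prec> \<Lambda> j) \<and>
    multiparameter_counting_process P X \<and>
    (\<forall>\<omega>\<in>space P. X 0 \<omega> = 0) \<and>
    independent_increments P X \<and>
    stationary_increments P X \<and>
    (\<forall>t\<ge>0. \<forall>n::nat.
       measure P {\<omega>\<in>space P. X t \<omega> = int n} =
       (\<Sum>x\<in>gcp_index_set m n.
          \<Prod>j=1..m. (\<Lambda> j \<bullet> t) ^ x j / fact (x j) * exp (- (\<Lambda> j \<bullet> t))))"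

text \<open>
  The library's \<open>poisson_pmf\<close> requires a positive rate, while the mean here is \<open>0\<close> at
  \<open>t = 0\<close>; hence the point probabilities are written out (with \<open>0 ^ 0 = 1\<close>).
\<close>

definition multiparameter_Poisson_process ::
    "'w measure \<Rightarrow> real ^ 'd \<Rightarrow> (real ^ 'd \<Rightarrow> 'w \<Rightarrow> int) \<Rightarrow> bool"
  where "multiparameter_Poisson_process P \<Lambda> X \<longleftrightarrow>
    0 \<prec> \<Lambda> \<and>
    multiparameter_counting_process P X \<and>
    (\<forall>\<omega>\<in>space P. X 0 \<omega> = 0) \<and>
    independent_increments P X \<and>
    stationary_increments P X \<and>
    (\<forall>t\<ge>0. \<forall>n::nat.
       measure P {\<omega>\<in>space P. X t \<omega> = int n} =
       (\<Lambda> \<bullet> t) ^ n / fact n * exp (- (\<Lambda> \<bullet> t)))"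

text \<open>
  Mutual independence of whole processes: each process, restricted to the orthant, is a random
  element of the product space of paths.
\<close>

definition independent_processes ::
    "'w measure \<Rightarrow> (nat \<Rightarrow> real ^ 'd \<Rightarrow> 'w \<Rightarrow> int) \<Rightarrow> nat set \<Rightarrow> bool"
  where "independent_processes P N J \<longleftrightarrow>
    prob_space.indep_vars P (\<lambda>_. Pi\<^sub>M {0..} (\<lambda>_. count_space UNIV))
      (\<lambda>j \<omega>. \<lambda>t\<in>{0..}. N j t \<omega>) J"

end

theory Submission
  imports Defs
begin

text \<open>
  Write \<open>M\<^sub>l\<close> for the weighted sum of the first \<open>l\<close> processes, so that \<open>M\<^sub>l = M\<^sub>l\<^sub>-\<^sub>1 + l N\<^sub>l\<close> with
  independent summands. If \<open>M\<^sub>l\<^sub>-\<^sub>1\<close> is a GCP (or zero), then \<open>M\<^sub>l\<close> is a GCP if and only if \<open>N\<^sub>l\<close> is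
  Poisson, and the theorem follows by induction on \<open>l\<close>. The law of a finite vector of increments
  of \<open>M\<^sub>l\<close> is a discrete convolution of those of \<open>M\<^sub>l\<^sub>-\<^sub>1\<close> and \<open>l N\<^sub>l\<close>, which gives one direction.
  Conversely, an increment of \<open>M\<^sub>l\<^sub>-\<^sub>1\<close> vanishes with positive probability, so the convolution
  equations form a triangular system with nonzero diagonal that determines the law of the
  increments of \<open>N\<^sub>l\<close>; the law required of a Poisson process solves the same system.
\<close>

subsection \<open>Convolution and deconvolution of discrete laws\<close>

lemma measurable_count_space_binop:
  fixes f :: "'a \<Rightarrow> 'b::countable" and g :: "'a \<Rightarrow> 'c::countable"
  assumes "f \<in> measurable M (count_space UNIV)" "g \<in> measurable M (count_space UNIV)"
  shows "(\<lambda>x. h (f x) (g x)) \<in> measurable M (count_space UNIV)"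
  by (rule measurable_compose_countable[OF measurable_compose[OF assms(1)] assms(2)]) simp

lemma restrict_eq_restrict_iff: "restrict f I = restrict g I \<longleftrightarrow> (\<forall>i\<in>I. f i = g i)"
  by (metis restrict_apply' restrict_ext)

text \<open>Strong induction on the height \<open>h x\<close>: the off-diagonal unknowns in the
  equation of \<open>x\<close> have smaller height, so they already agree and cancel, and the
  diagonal coefficient can be divided out. The index type stays abstract so that both numbers and
  integer vectors can index the unknowns.\<close>

lemma triangular_system_unique:
  fixes A :: "'a \<Rightarrow> 'a \<Rightarrow> real" and h :: "'a \<Rightarrow> nat"
  assumes S: "\<And>x. x \<in> X \<Longrightarrow> finite (S x)" "\<And>x. x \<in> X \<Longrightarrow> x \<in> S x" "\<And>x. x \<in> X \<Longrightarrow> S x \<subseteq> X"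
    and decr: "\<And>x y. x \<in> X \<Longrightarrow> y \<in> S x \<Longrightarrow> y \<noteq> x \<Longrightarrow> h y < h x"
    and diag: "\<And>x. x \<in> X \<Longrightarrow> A x x \<noteq> 0"
    and eq: "\<And>x. x \<in> X \<Longrightarrow> (\<Sum>y\<in>S x. A x y * q y) = (\<Sum>y\<in>S x. A x y * r y)"
    and "x \<in> X"
  shows "q x = r x"
  using \<open>x \<in> X\<close>
proof (induction "h x" arbitrary: x rule: less_induct)
  case less
  have "q y = r y" if "y \<in> S x - {x}" for y
    using less S(3) decr that by blast
  then have "(\<Sum>y\<in>S x - {x}. A x y * q y) = (\<Sum>y\<in>S x - {x}. A x y * r y)"
    by simp
  with eq[OF less.prems] have "A x x * q x = A x x * r x"
    using S(1,2)[OF less.prems] by (simp add: sum.remove)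
  then show ?case
    using diag[OF less.prems] by simp
qed

section \<open>Discrete laws, their convolution, and independence tested on single points\<close>

context prob_space
begin

lemma measurable_restrict_count_space:
  assumes "\<And>i. i \<in> I \<Longrightarrow> X i \<in> measurable M (count_space UNIV)"
  shows "(\<lambda>\<omega>. \<lambda>i\<in>I. X i \<omega>) \<in> measurable M (Pi\<^sub>M I (\<lambda>_. count_space UNIV))"
  using assms by (intro measurable_restrict) auto

text \<open>Independence says that the joint law is the product of the marginals. Both live on the
  countable set of extensional functions on \<open>I\<close>, whose product sigma-algebra is the
  full power set, so they are equal as soon as they agree on singletons.\<close>

lemma indep_vars_iff_prob_eq_prod:
  fixes X :: "'i \<Rightarrow> 'a \<Rightarrow> 'b::countable"
  assumes fin: "finite I"
    and rv: "\<And>i. i \<in> I \<Longrightarrow> X i \<in> measurable M (count_space UNIV)"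
  shows "indep_vars (\<lambda>_. count_space UNIV) X I \<longleftrightarrow>
    (\<forall>a. prob {\<omega>\<in>space M. \<forall>i\<in>I. X i \<omega> = a i} = (\<Prod>i\<in>I. prob {\<omega>\<in>space M. X i \<omega> = a i}))"
proof (cases "I = {}")
  case True
  then show ?thesis
    by (simp add: indep_vars_def indep_sets_def prob_space)
next
  case False
  let ?C = "\<lambda>_::'i. count_space (UNIV :: 'b set)"
  let ?L = "distr M (Pi\<^sub>M I ?C) (\<lambda>\<omega>. \<lambda>i\<in>I. X i \<omega>)"
  let ?R = "Pi\<^sub>M I (\<lambda>i. distr M (count_space UNIV) (X i))"
  \<comment> \<open>The locale asks for a probability measure at every index; outside
    \<open>I\<close>, where \<open>X i\<close> need not be measurable, a point mass serves as
    filler.\<close>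
  interpret R: product_prob_space "\<lambda>i. if i \<in> I then distr M (count_space UNIV) (X i) else return (count_space UNIV) undefined" I
    by (intro product_prob_spaceI) (auto intro!: prob_space_distr rv prob_space_return)
  have R_cong: "?R = Pi\<^sub>M I (\<lambda>i. if i \<in> I then distr M (count_space UNIV) (X i) else return (count_space UNIV) undefined)"
    by (intro PiM_cong) auto
  have meas[measurable]: "(\<lambda>\<omega>. \<lambda>i\<in>I. X i \<omega>) \<in> measurable M (Pi\<^sub>M I ?C)"
    by (intro measurable_restrict_count_space rv)
  have countable: "countable (PiE I (\<lambda>_. UNIV :: 'b set))"
    using fin by (intro countable_PiE) auto
  have Pow: "sets (Pi\<^sub>M I ?C) = Pow (PiE I (\<lambda>_. UNIV))"
    using fin by (subst count_space_PiM_finite) auto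
  have sets_R: "sets ?R = sets (Pi\<^sub>M I ?C)"
    by (intro sets_PiM_cong) auto
  have L: "emeasure ?L {a} = prob {\<omega>\<in>space M. \<forall>i\<in>I. X i \<omega> = a i}" if "a \<in> PiE I (\<lambda>_. UNIV)" for a
  proof -
    have "(\<lambda>\<omega>. \<lambda>i\<in>I. X i \<omega>) -` {a} \<inter> space M = {\<omega>\<in>space M. \<forall>i\<in>I. X i \<omega> = a i}"
      using that by (auto simp: fun_eq_iff PiE_def extensional_def)
    then show ?thesis
      using that by (subst emeasure_distr) (auto simp: Pow emeasure_eq_measure)
  qed
  have R: "emeasure ?R {a} = (\<Prod>i\<in>I. prob {\<omega>\<in>space M. X i \<omega> = a i})" if a: "a \<in> PiE I (\<lambda>_. UNIV)" for a
  proof -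
    have "{a} = PiE I (\<lambda>i. {a i})"
      using PiE_singleton[of a I] a by (auto simp: PiE_def)
    then have "emeasure ?R {a} = (\<Prod>i\<in>I. emeasure (distr M (count_space UNIV) (X i)) {a i})"
      using fin unfolding R_cong by (simp only:) (subst R.emeasure_PiM, auto intro!: prod.cong)
    also have "\<dots> = (\<Prod>i\<in>I. ennreal (prob {\<omega>\<in>space M. X i \<omega> = a i}))"
      using rv by (intro prod.cong refl)
        (auto simp: emeasure_distr emeasure_eq_measure vimage_def intro!: arg_cong[where f=prob])
    finally show ?thesis
      by (simp add: prod_ennreal)
  qed
  have "indep_vars ?C X I \<longleftrightarrow> ?L = ?R"
    using indep_vars_iff_distr_eq_PiM'[of I X ?C] False rv by simp
  also have "\<dots> \<longleftrightarrow> (\<forall>a\<in>PiE I (\<lambda>_. UNIV). emeasure ?L {a} = emeasure ?R {a})"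
    using measure_eqI_countable[of ?L "PiE I (\<lambda>_. UNIV)" ?R] countable by (metis sets_R Pow sets_distr)
  also have "\<dots> \<longleftrightarrow> (\<forall>a\<in>PiE I (\<lambda>_. UNIV). prob {\<omega>\<in>space M. \<forall>i\<in>I. X i \<omega> = a i} = (\<Prod>i\<in>I. prob {\<omega>\<in>space M. X i \<omega> = a i}))"
    using L R by (simp add: prod_nonneg)
  also have "\<dots> \<longleftrightarrow> (\<forall>a. prob {\<omega>\<in>space M. \<forall>i\<in>I. X i \<omega> = a i} = (\<Prod>i\<in>I. prob {\<omega>\<in>space M. X i \<omega> = a i}))"
  proof safe
    fix a :: "'i \<Rightarrow> 'b"
    assume *: "\<forall>a\<in>PiE I (\<lambda>_. UNIV). prob {\<omega>\<in>space M. \<forall>i\<in>I. X i \<omega> = a i} = (\<Prod>i\<in>I. prob {\<omega>\<in>space M. X i \<omega> = a i})"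
    show "prob {\<omega>\<in>space M. \<forall>i\<in>I. X i \<omega> = a i} = (\<Prod>i\<in>I. prob {\<omega>\<in>space M. X i \<omega> = a i})"
      \<comment> \<open>Both sides look at \<open>a\<close> on \<open>I\<close> only, so an
        arbitrary \<open>a\<close> may be replaced by its extensional restriction.\<close>
      using *[THEN bspec, of "restrict a I"] by simp
  qed auto
  finally show ?thesis .
qed

lemma distr_count_space_eq_iff:
  fixes X Y :: "'a \<Rightarrow> 'b::countable"
  assumes "X \<in> measurable M (count_space UNIV)" "Y \<in> measurable M (count_space UNIV)"
  shows "distr M (count_space UNIV) X = distr M (count_space UNIV) Y \<longleftrightarrow>
    (\<forall>a. prob {\<omega>\<in>space M. X \<omega> = a} = prob {\<omega>\<in>space M. Y \<omega> = a})"
proof -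
  have law: "emeasure (distr M (count_space UNIV) V) {a} = prob {\<omega>\<in>space M. V \<omega> = a}"
    if "V \<in> measurable M (count_space UNIV)" for V :: "'a \<Rightarrow> 'b" and a
    using that by (auto simp: emeasure_distr emeasure_eq_measure intro!: arg_cong[where f=prob])
  have "distr M (count_space UNIV) X = distr M (count_space UNIV) Y \<longleftrightarrow>
    (\<forall>a. emeasure (distr M (count_space UNIV) X) {a} = emeasure (distr M (count_space UNIV) Y) {a})"
    by (auto intro!: measure_eqI_countable[where A=UNIV])
  then show ?thesis
    using assms by (simp add: law)
qed

text \<open>The event is split according to the value of \<open>V\<close>, and independence factors
  each piece. Only singletons have to be measurable, so the result serves integer variables and
  random vectors alike.\<close>

lemma prob_graph_eq_sum:
  assumes ind: "indep_var A U B V" and "finite S"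
    and sing: "\<And>v. v \<in> S \<Longrightarrow> {v} \<in> sets B" "\<And>v. v \<in> S \<Longrightarrow> {g v} \<in> sets A"
  shows "prob {\<omega>\<in>space M. V \<omega> \<in> S \<and> U \<omega> = g (V \<omega>)} =
    (\<Sum>v\<in>S. prob {\<omega>\<in>space M. U \<omega> = g v} * prob {\<omega>\<in>space M. V \<omega> = v})"
proof -
  have ev: "{\<omega>\<in>space M. U \<omega> = g v \<and> V \<omega> = v} = (U -` {g v} \<inter> space M) \<inter> (V -` {v} \<inter> space M)" for v
    by auto
  have meas: "{\<omega>\<in>space M. U \<omega> = g v \<and> V \<omega> = v} \<in> events" if "v \<in> S" for v
    unfolding ev using sing that indep_var_rv1[OF ind] indep_var_rv2[OF ind]
    by (intro sets.Int measurable_sets[where A=A] measurable_sets[where A=B]) auto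
  have "{\<omega>\<in>space M. V \<omega> \<in> S \<and> U \<omega> = g (V \<omega>)} = (\<Union>v\<in>S. {\<omega>\<in>space M. U \<omega> = g v \<and> V \<omega> = v})"
    by auto
  then have "prob {\<omega>\<in>space M. V \<omega> \<in> S \<and> U \<omega> = g (V \<omega>)} = (\<Sum>v\<in>S. prob {\<omega>\<in>space M. U \<omega> = g v \<and> V \<omega> = v})"
    using meas \<open>finite S\<close> by (simp only:) (intro finite_measure_finite_Union, auto simp: disjoint_family_on_def)
  also have "\<dots> = (\<Sum>v\<in>S. prob {\<omega>\<in>space M. U \<omega> = g v} * prob {\<omega>\<in>space M. V \<omega> = v})"
  proof (intro sum.cong refl)
    fix v assume v: "v \<in> S"
    have "(\<lambda>x. (U x, V x)) -` ({g v} \<times> {v}) \<inter> space M = {\<omega>\<in>space M. U \<omega> = g v \<and> V \<omega> = v}"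
      "U -` {g v} \<inter> space M = {\<omega>\<in>space M. U \<omega> = g v}" "V -` {v} \<inter> space M = {\<omega>\<in>space M. V \<omega> = v}"
      by auto
    then show "prob {\<omega>\<in>space M. U \<omega> = g v \<and> V \<omega> = v} = prob {\<omega>\<in>space M. U \<omega> = g v} * prob {\<omega>\<in>space M. V \<omega> = v}"
      using indep_varD[OF ind sing(2)[OF v] sing(1)[OF v]] by simp
  qed
  finally show ?thesis .
qed

text \<open>Since \<open>U\<close> is nonnegative, \<open>c * V \<le> w\<close>; this confines
  \<open>V\<close> to a finite range and makes the convolution a finite sum. For negative
  \<open>w\<close> the range is empty, as is the event.\<close>

lemma prob_add_eq_sum:
  fixes U V :: "'a \<Rightarrow> int" and c w :: int
  assumes ind: "indep_var (count_space UNIV) U (count_space UNIV) V"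
    and nonneg: "\<And>\<omega>. \<omega> \<in> space M \<Longrightarrow> 0 \<le> U \<omega>" "\<And>\<omega>. \<omega> \<in> space M \<Longrightarrow> 0 \<le> V \<omega>" and c: "c > 0"
  shows "prob {\<omega>\<in>space M. U \<omega> + c * V \<omega> = w} =
    (\<Sum>v\<in>{0..w div c}. prob {\<omega>\<in>space M. U \<omega> = w - c * v} * prob {\<omega>\<in>space M. V \<omega> = v})"
proof -
  have "{\<omega>\<in>space M. U \<omega> + c * V \<omega> = w} = {\<omega>\<in>space M. V \<omega> \<in> {0..w div c} \<and> U \<omega> = w - c * V \<omega>}"
  proof (intro Collect_cong conj_cong refl)
    fix \<omega> assume "\<omega> \<in> space M"
    with nonneg have "0 \<le> U \<omega>" "0 \<le> V \<omega>" by auto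
    moreover have "V \<omega> \<le> w div c" if "U \<omega> + c * V \<omega> = w"
      using zdiv_mono1[of "V \<omega> * c" w c] that \<open>0 \<le> U \<omega>\<close> c by (simp add: algebra_simps)
    ultimately show "U \<omega> + c * V \<omega> = w \<longleftrightarrow> V \<omega> \<in> {0..w div c} \<and> U \<omega> = w - c * V \<omega>"
      by auto
  qed
  then show ?thesis
    using prob_graph_eq_sum[OF ind, of "{0..w div c}" "\<lambda>v. w - c * v"] by simp
qed

text \<open>The same splitting, by the value of the whole vector \<open>V\<close>. Independence is
  assumed between the two vectors, while the coordinates within each may depend on one another.
  Restriction to \<open>I\<close> turns coordinatewise equality on \<open>I\<close> into equality of
  functions.\<close>

lemma prob_add_vector_eq_sum:
  fixes U V :: "'i \<Rightarrow> 'a \<Rightarrow> int" and c :: int and w :: "'i \<Rightarrow> int"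
  assumes fin: "finite I"
    and ind: "indep_var (Pi\<^sub>M I (\<lambda>_. count_space UNIV)) (\<lambda>\<omega>. \<lambda>i\<in>I. U i \<omega>)
      (Pi\<^sub>M I (\<lambda>_. count_space UNIV)) (\<lambda>\<omega>. \<lambda>i\<in>I. V i \<omega>)"
    and nonneg: "\<And>i \<omega>. i \<in> I \<Longrightarrow> \<omega> \<in> space M \<Longrightarrow> 0 \<le> U i \<omega>" "\<And>i \<omega>. i \<in> I \<Longrightarrow> \<omega> \<in> space M \<Longrightarrow> 0 \<le> V i \<omega>"
    and c: "c > 0"
  shows "prob {\<omega>\<in>space M. \<forall>i\<in>I. U i \<omega> + c * V i \<omega> = w i} =
    (\<Sum>v\<in>PiE I (\<lambda>i. {0..w i div c}). prob {\<omega>\<in>space M. \<forall>i\<in>I. U i \<omega> = w i - c * v i} *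
      prob {\<omega>\<in>space M. \<forall>i\<in>I. V i \<omega> = v i})"
proof -
  let ?S = "PiE I (\<lambda>i. {0..w i div c})"
  let ?g = "\<lambda>v. \<lambda>i\<in>I. w i - c * v i"
  have sing: "{v} \<in> sets (Pi\<^sub>M I (\<lambda>_. count_space (UNIV :: int set)))" if "v \<in> extensional I" for v
    using fin that by (subst count_space_PiM_finite) (auto simp: PiE_def)
  have event: "{\<omega>\<in>space M. \<forall>i\<in>I. U i \<omega> + c * V i \<omega> = w i} =
    {\<omega>\<in>space M. (\<lambda>i\<in>I. V i \<omega>) \<in> ?S \<and> (\<lambda>i\<in>I. U i \<omega>) = ?g (\<lambda>i\<in>I. V i \<omega>)}"
  proof (intro Collect_cong conj_cong refl)
    fix \<omega> assume "\<omega> \<in> space M"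
    with nonneg have nn: "\<And>i. i \<in> I \<Longrightarrow> 0 \<le> U i \<omega>" "\<And>i. i \<in> I \<Longrightarrow> 0 \<le> V i \<omega>" by auto
    have "V i \<omega> \<le> w i div c" if "U i \<omega> + c * V i \<omega> = w i" "i \<in> I" for i
      using zdiv_mono1[of "V i \<omega> * c" "w i" c] that nn(1)[of i] c by (simp add: algebra_simps)
    with nn have "U i \<omega> + c * V i \<omega> = w i \<longleftrightarrow> V i \<omega> \<in> {0..w i div c} \<and> U i \<omega> = w i - c * V i \<omega>" if "i \<in> I" for i
      using that by auto
    moreover have "(\<lambda>i\<in>I. V i \<omega>) \<in> ?S \<longleftrightarrow> (\<forall>i\<in>I. V i \<omega> \<in> {0..w i div c})"
      by (simp add: PiE_iff)
    moreover have "(\<lambda>i\<in>I. U i \<omega>) = ?g (\<lambda>i\<in>I. V i \<omega>) \<longleftrightarrow> (\<forall>i\<in>I. U i \<omega> = w i - c * V i \<omega>)"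
      by (simp add: restrict_eq_restrict_iff)
    ultimately show "(\<forall>i\<in>I. U i \<omega> + c * V i \<omega> = w i) \<longleftrightarrow>
        (\<lambda>i\<in>I. V i \<omega>) \<in> ?S \<and> (\<lambda>i\<in>I. U i \<omega>) = ?g (\<lambda>i\<in>I. V i \<omega>)"
      by blast
  qed
  have "prob {\<omega>\<in>space M. \<forall>i\<in>I. U i \<omega> + c * V i \<omega> = w i} =
    (\<Sum>v\<in>?S. prob {\<omega>\<in>space M. (\<lambda>i\<in>I. U i \<omega>) = ?g v} * prob {\<omega>\<in>space M. (\<lambda>i\<in>I. V i \<omega>) = v})"
    unfolding event
  proof (rule prob_graph_eq_sum[OF ind])
    show "finite ?S"
      using fin by (intro finite_PiE) auto
    show "{?g v} \<in> sets (Pi\<^sub>M I (\<lambda>_. count_space UNIV))" for v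
      by (rule sing) (rule restrict_extensional)
    show "{v} \<in> sets (Pi\<^sub>M I (\<lambda>_. count_space UNIV))" if "v \<in> ?S" for v
      using that unfolding PiE_def by (intro sing) (rule IntD2)
  qed
  also have "\<dots> = (\<Sum>v\<in>?S. prob {\<omega>\<in>space M. \<forall>i\<in>I. U i \<omega> = w i - c * v i} * prob {\<omega>\<in>space M. \<forall>i\<in>I. V i \<omega> = v i})"
  proof (intro sum.cong refl)
    fix v assume v: "v \<in> ?S"
    have "(\<lambda>i\<in>I. U i \<omega>) = ?g v \<longleftrightarrow> (\<forall>i\<in>I. U i \<omega> = w i - c * v i)" for \<omega>
      by (rule restrict_eq_restrict_iff)
    moreover have "(\<lambda>i\<in>I. V i \<omega>) = v \<longleftrightarrow> (\<forall>i\<in>I. V i \<omega> = v i)" for \<omega>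
      using restrict_eq_restrict_iff[of "\<lambda>i. V i \<omega>" I v] unfolding PiE_restrict[OF v] .
    ultimately show "prob {\<omega>\<in>space M. (\<lambda>i\<in>I. U i \<omega>) = ?g v} * prob {\<omega>\<in>space M. (\<lambda>i\<in>I. V i \<omega>) = v} =
      prob {\<omega>\<in>space M. \<forall>i\<in>I. U i \<omega> = w i - c * v i} * prob {\<omega>\<in>space M. \<forall>i\<in>I. V i \<omega> = v i}"
      by (simp only:)
  qed
  finally show ?thesis .
qed

text \<open>The convolution in the shape of the recursion for the GCP masses. The natural
  subtraction \<open>n - c * v\<close> never truncates, because
  \<open>v \<le> n div c\<close>.\<close>

lemma prob_add_eq_sum_nat:
  fixes U V :: "'a \<Rightarrow> int" and c n :: nat
  assumes ind: "indep_var (count_space UNIV) U (count_space UNIV) V"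
    and nonneg: "\<And>\<omega>. \<omega> \<in> space M \<Longrightarrow> 0 \<le> U \<omega>" "\<And>\<omega>. \<omega> \<in> space M \<Longrightarrow> 0 \<le> V \<omega>" and c: "c > 0"
  shows "prob {\<omega>\<in>space M. U \<omega> + int c * V \<omega> = int n} =
    (\<Sum>v\<in>{0..n div c}. prob {\<omega>\<in>space M. U \<omega> = int (n - c * v)} * prob {\<omega>\<in>space M. V \<omega> = int v})"
proof -
  have "{0..int n div int c} = int ` {0..n div c}"
    by (simp add: image_int_atLeastAtMost flip: zdiv_int)
  moreover have "int n - int c * int v = int (n - c * v)" if "v \<in> {0..n div c}" for v
    using that c by (simp add: of_nat_diff less_eq_div_iff_mult_less_eq mult.commute)
  ultimately show ?thesis
    using prob_add_eq_sum[OF ind nonneg, of "int c" "int n"] c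
    by (simp add: sum.reindex)
qed

text \<open>Taken only at the multiples \<open>c * n\<close>, the convolution equations involve
  exactly the unknowns \<open>v \<le> n\<close>. They form a triangular system whose diagonal
  entries are the probability that \<open>U\<close> vanishes, and both the law of \<open>V\<close>
  and \<open>r\<close> solve it.\<close>

lemma prob_cancel_summand:
  fixes U V :: "'a \<Rightarrow> int" and c n :: nat
  assumes ind: "indep_var (count_space UNIV) U (count_space UNIV) V"
    and nonneg: "\<And>\<omega>. \<omega> \<in> space M \<Longrightarrow> 0 \<le> U \<omega>" "\<And>\<omega>. \<omega> \<in> space M \<Longrightarrow> 0 \<le> V \<omega>" and c: "c > 0"
    and U0: "prob {\<omega>\<in>space M. U \<omega> = 0} \<noteq> 0"
    and law: "\<And>n. prob {\<omega>\<in>space M. U \<omega> + int c * V \<omega> = int n} =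
      (\<Sum>v\<in>{0..n div c}. prob {\<omega>\<in>space M. U \<omega> = int (n - c * v)} * r v)"
  shows "prob {\<omega>\<in>space M. V \<omega> = int n} = r n"
proof (rule triangular_system_unique[where X=UNIV and S="\<lambda>n. {0..n}" and h="\<lambda>n. n"
      and A="\<lambda>n v. prob {\<omega>\<in>space M. U \<omega> = int (c * n - c * v)}"])
  show "(\<Sum>v\<in>{0..n}. prob {\<omega>\<in>space M. U \<omega> = int (c * n - c * v)} * prob {\<omega>\<in>space M. V \<omega> = int v}) =
    (\<Sum>v\<in>{0..n}. prob {\<omega>\<in>space M. U \<omega> = int (c * n - c * v)} * r v)" for n
    using law[of "c * n"] prob_add_eq_sum_nat[OF ind nonneg c, of "c * n"] c by simp
qed (use U0 in auto)

text \<open>The one-dimensional convolutions are multiplied and the product of sums is expanded;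
  independence of the coordinates of \<open>U\<close> merges their factors into a joint probability.
  The coefficients thus coincide with those in \<open>prob_add_vector_eq_sum\<close>: the joint law
  of the sums and the product of their marginals are images of the corresponding laws of
  \<open>V\<close> under one matrix.\<close>

lemma prod_prob_add_eq_sum:
  fixes U V :: "'i \<Rightarrow> 'a \<Rightarrow> int" and c :: int and w :: "'i \<Rightarrow> int"
  assumes fin: "finite I"
    and ind: "indep_var (Pi\<^sub>M I (\<lambda>_. count_space UNIV)) (\<lambda>\<omega>. \<lambda>i\<in>I. U i \<omega>)
      (Pi\<^sub>M I (\<lambda>_. count_space UNIV)) (\<lambda>\<omega>. \<lambda>i\<in>I. V i \<omega>)"
    and nonneg: "\<And>i \<omega>. i \<in> I \<Longrightarrow> \<omega> \<in> space M \<Longrightarrow> 0 \<le> U i \<omega>" "\<And>i \<omega>. i \<in> I \<Longrightarrow> \<omega> \<in> space M \<Longrightarrow> 0 \<le> V i \<omega>"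
    and c: "c > 0"
    and indU: "indep_vars (\<lambda>_. count_space UNIV) U I"
  shows "(\<Prod>i\<in>I. prob {\<omega>\<in>space M. U i \<omega> + c * V i \<omega> = w i}) =
    (\<Sum>v\<in>PiE I (\<lambda>i. {0..w i div c}). prob {\<omega>\<in>space M. \<forall>i\<in>I. U i \<omega> = w i - c * v i} *
      (\<Prod>i\<in>I. prob {\<omega>\<in>space M. V i \<omega> = v i}))"
proof -
  have "indep_var (count_space UNIV) (U i) (count_space UNIV) (V i)" if "i \<in> I" for i
    using indep_var_compose[OF ind measurable_component_singleton[OF that] measurable_component_singleton[OF that]] that
    by (simp add: o_def)
  then have "(\<Prod>i\<in>I. prob {\<omega>\<in>space M. U i \<omega> + c * V i \<omega> = w i}) =
    (\<Prod>i\<in>I. \<Sum>v\<in>{0..w i div c}. prob {\<omega>\<in>space M. U i \<omega> = w i - c * v} * prob {\<omega>\<in>space M. V i \<omega> = v})"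
    using nonneg c by (intro prod.cong refl prob_add_eq_sum) auto
  also have "\<dots> = (\<Sum>v\<in>PiE I (\<lambda>i. {0..w i div c}).
      \<Prod>i\<in>I. prob {\<omega>\<in>space M. U i \<omega> = w i - c * v i} * prob {\<omega>\<in>space M. V i \<omega> = v i})"
    using fin by (intro prod_sum_PiE) auto
  also have "\<dots> = (\<Sum>v\<in>PiE I (\<lambda>i. {0..w i div c}). prob {\<omega>\<in>space M. \<forall>i\<in>I. U i \<omega> = w i - c * v i} *
      (\<Prod>i\<in>I. prob {\<omega>\<in>space M. V i \<omega> = v i}))"
  proof (intro sum.cong refl)
    fix v
    have rvU: "U i \<in> measurable M (count_space UNIV)" if "i \<in> I" for i
      using indU that by (auto simp: indep_vars_def)
    have "(\<Prod>i\<in>I. prob {\<omega>\<in>space M. U i \<omega> = w i - c * v i}) = prob {\<omega>\<in>space M. \<forall>i\<in>I. U i \<omega> = w i - c * v i}"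
      using indep_vars_iff_prob_eq_prod[OF fin, of U] rvU indU by simp
    then show "(\<Prod>i\<in>I. prob {\<omega>\<in>space M. U i \<omega> = w i - c * v i} * prob {\<omega>\<in>space M. V i \<omega> = v i}) =
        prob {\<omega>\<in>space M. \<forall>i\<in>I. U i \<omega> = w i - c * v i} * (\<Prod>i\<in>I. prob {\<omega>\<in>space M. V i \<omega> = v i})"
      by (simp add: prod.distrib)
  qed
  finally show ?thesis .
qed

text \<open>Independence of the sums means that the two expansions agree at every \<open>w\<close>.
  This is immediate if the joint law of \<open>V\<close> is the product of its marginals.
  Conversely, the joint law and the product solve the same triangular system and therefore
  agree.\<close>

lemma
  fixes U V :: "'i \<Rightarrow> 'a \<Rightarrow> int" and c :: int
  assumes fin: "finite I"
    and ind: "indep_var (Pi\<^sub>M I (\<lambda>_. count_space UNIV)) (\<lambda>\<omega>. \<lambda>i\<in>I. U i \<omega>)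
      (Pi\<^sub>M I (\<lambda>_. count_space UNIV)) (\<lambda>\<omega>. \<lambda>i\<in>I. V i \<omega>)"
    and nonneg: "\<And>i \<omega>. i \<in> I \<Longrightarrow> \<omega> \<in> space M \<Longrightarrow> 0 \<le> U i \<omega>" "\<And>i \<omega>. i \<in> I \<Longrightarrow> \<omega> \<in> space M \<Longrightarrow> 0 \<le> V i \<omega>"
    and c: "c > 0"
    and indU: "indep_vars (\<lambda>_. count_space UNIV) U I"
  shows indep_vars_add_independent:
      "indep_vars (\<lambda>_. count_space UNIV) V I \<Longrightarrow>
        indep_vars (\<lambda>_. count_space UNIV) (\<lambda>i \<omega>. U i \<omega> + c * V i \<omega>) I"
    and indep_vars_cancel_summand:
      "indep_vars (\<lambda>_. count_space UNIV) (\<lambda>i \<omega>. U i \<omega> + c * V i \<omega>) I \<Longrightarrow>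
        (\<And>i. i \<in> I \<Longrightarrow> prob {\<omega>\<in>space M. U i \<omega> = 0} \<noteq> 0) \<Longrightarrow>
        indep_vars (\<lambda>_. count_space UNIV) V I"
proof -
  have rvU: "U i \<in> measurable M (count_space UNIV)" if "i \<in> I" for i
    using indU that by (auto simp: indep_vars_def)
  have rvV: "V i \<in> measurable M (count_space UNIV)" if "i \<in> I" for i
    using measurable_compose[OF indep_var_rv2[OF ind] measurable_component_singleton[OF that]] that
    by simp
  have rvW: "(\<lambda>\<omega>. U i \<omega> + c * V i \<omega>) \<in> measurable M (count_space UNIV)" if "i \<in> I" for i
    using rvU[OF that] rvV[OF that] by (rule measurable_count_space_binop)
  note joint = prob_add_vector_eq_sum[OF fin ind nonneg c]
  note marginal = prod_prob_add_eq_sum[OF fin ind nonneg c indU]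
  note iffU = indep_vars_iff_prob_eq_prod[of I U, OF fin rvU]
  note iffV = indep_vars_iff_prob_eq_prod[of I V, OF fin rvV]
  note iffW = indep_vars_iff_prob_eq_prod[of I "\<lambda>i \<omega>. U i \<omega> + c * V i \<omega>", OF fin rvW]
  show "indep_vars (\<lambda>_. count_space UNIV) (\<lambda>i \<omega>. U i \<omega> + c * V i \<omega>) I"
    if "indep_vars (\<lambda>_. count_space UNIV) V I"
    using that by (simp add: iffV iffW joint marginal)
  show "indep_vars (\<lambda>_. count_space UNIV) V I"
    if indW: "indep_vars (\<lambda>_. count_space UNIV) (\<lambda>i \<omega>. U i \<omega> + c * V i \<omega>) I"
      and U0: "\<And>i. i \<in> I \<Longrightarrow> prob {\<omega>\<in>space M. U i \<omega> = 0} \<noteq> 0"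
  proof (subst iffV, (assumption | intro allI)+)
    fix a
    show "prob {\<omega>\<in>space M. \<forall>i\<in>I. V i \<omega> = a i} = (\<Prod>i\<in>I. prob {\<omega>\<in>space M. V i \<omega> = a i})"
    \<comment> \<open>With a negative coordinate both sides vanish. What remains are nonnegative
      vectors, on which the coordinate sum is a height in the natural numbers.\<close>
    proof (cases "\<forall>i\<in>I. 0 \<le> a i")
      case False
      then obtain i where i: "i \<in> I" "\<not> 0 \<le> a i" by auto
      have null: "prob {\<omega>\<in>space M. Q \<omega>} = 0" if "\<And>\<omega>. Q \<omega> \<Longrightarrow> V i \<omega> = a i" for Q
      proof -
        have "{\<omega>\<in>space M. Q \<omega>} = {}"
          using nonneg(2)[OF i(1)] i(2) that by fastforce
        then show ?thesis
          by (simp only: measure_empty)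
      qed
      have "(\<Prod>i\<in>I. prob {\<omega>\<in>space M. V i \<omega> = a i}) = 0"
        using fin i(1) null[of "\<lambda>\<omega>. V i \<omega> = a i"] by (intro prod_zero) auto
      moreover have "prob {\<omega>\<in>space M. \<forall>i\<in>I. V i \<omega> = a i} = 0"
        using i(1) by (intro null) auto
      ultimately show ?thesis
        by simp
    next
      case True
      let ?q = "\<lambda>a. prob {\<omega>\<in>space M. \<forall>i\<in>I. V i \<omega> = a i}"
      let ?r = "\<lambda>a. \<Prod>i\<in>I. prob {\<omega>\<in>space M. V i \<omega> = a i}"
      have "?q (restrict a I) = ?r (restrict a I)"
      \<comment> \<open>The equations are taken at \<open>w = c * a\<close>, so that the range of
        summation is the box below \<open>a\<close>; a different point of the box has a smaller
        coordinate sum.\<close>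
      proof (rule triangular_system_unique[where X="PiE I (\<lambda>_. {0..})" and S="\<lambda>a. PiE I (\<lambda>i. {0..a i})"
            and h="\<lambda>a. nat (\<Sum>i\<in>I. a i)" and q="?q" and r="?r"
            and A="\<lambda>a v. prob {\<omega>\<in>space M. \<forall>i\<in>I. U i \<omega> = c * a i - c * v i}"])
        fix x y assume xy: "x \<in> PiE I (\<lambda>_. {0::int..})" "y \<in> PiE I (\<lambda>i. {0..x i})" "y \<noteq> x"
        then have "\<not> (\<forall>i\<in>I. y i = x i)"
          using extensionalityI[of y I x] by (auto simp: PiE_def)
        then obtain i where i: "i \<in> I" "y i \<noteq> x i"
          by blast
        with PiE_mem[OF xy(2) i(1)] have "y i < x i"
          by simp
        then have "(\<Sum>i\<in>I. y i) < (\<Sum>i\<in>I. x i)"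
          using xy i fin by (intro sum_strict_mono_ex1) (auto simp: PiE_iff)
        moreover have "0 \<le> (\<Sum>i\<in>I. y i)"
          using xy by (intro sum_nonneg) (auto simp: PiE_iff)
        ultimately show "nat (\<Sum>i\<in>I. y i) < nat (\<Sum>i\<in>I. x i)"
          by simp
      next
        fix x assume "x \<in> PiE I (\<lambda>_. {0::int..})"
        \<comment> \<open>The diagonal coefficient is the probability that all \<open>U i\<close>
          vanish, which factors into nonzero terms.\<close>
        have "prob {\<omega>\<in>space M. \<forall>i\<in>I. U i \<omega> = c * x i - c * x i} = (\<Prod>i\<in>I. prob {\<omega>\<in>space M. U i \<omega> = 0})"
          using indU iffU by simp
        then show "prob {\<omega>\<in>space M. \<forall>i\<in>I. U i \<omega> = c * x i - c * x i} \<noteq> 0"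
          using U0 fin by simp
      next
        fix x assume "x \<in> PiE I (\<lambda>_. {0::int..})"
        have "prob {\<omega>\<in>space M. \<forall>i\<in>I. U i \<omega> + c * V i \<omega> = c * x i} =
            (\<Prod>i\<in>I. prob {\<omega>\<in>space M. U i \<omega> + c * V i \<omega> = c * x i})"
          using indW iffW by simp
        then show "(\<Sum>v\<in>PiE I (\<lambda>i. {0..x i}). prob {\<omega>\<in>space M. \<forall>i\<in>I. U i \<omega> = c * x i - c * v i} * ?q v) =
            (\<Sum>v\<in>PiE I (\<lambda>i. {0..x i}). prob {\<omega>\<in>space M. \<forall>i\<in>I. U i \<omega> = c * x i - c * v i} * ?r v)"
          using joint[of "\<lambda>i. c * x i"] marginal[of "\<lambda>i. c * x i"] c by simp
      next
        fix x assume "x \<in> PiE I (\<lambda>_. {0::int..})"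
        then show "PiE I (\<lambda>i. {0..x i}) \<subseteq> PiE I (\<lambda>_. {0..})"
          by (auto simp: PiE_iff)
      qed (use fin True in \<open>auto intro!: finite_PiE simp: PiE_iff extensional_def\<close>)
      then show ?thesis by simp
    qed
  qed
qed

end

subsection \<open>The index sets of the GCP law\<close>

text \<open>Every weight \<open>j\<close> is at least 1, so each entry of a tuple is bounded by the
  weighted sum \<open>n\<close>.\<close>

lemma gcp_index_set_finite: "finite (gcp_index_set m n)"
proof (rule finite_subset)
  show "gcp_index_set m n \<subseteq> PiE {1..m} (\<lambda>_. {0..n})"
  proof
    fix x assume x: "x \<in> gcp_index_set m n"
    have "x j \<le> n" if j: "j \<in> {1..m}" for j
    proof -
      have "x j \<le> j * x j"
        using j by simp
      also have "\<dots> \<le> (\<Sum>j=1..m. j * x j)"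
        using j by (intro member_le_sum) auto
      finally show ?thesis
        using x by (simp add: gcp_index_set_def)
    qed
    then show "x \<in> PiE {1..m} (\<lambda>_. {0..n})"
      using x by (auto simp: gcp_index_set_def PiE_iff)
  qed
qed (auto intro: finite_PiE)

text \<open>The mass at \<open>n\<close> of the weighted sum of independent variables, the
  \<open>j\<close>-th having weight \<open>j\<close> and point masses \<open>f j\<close>. Leaving
  \<open>f\<close> arbitrary separates the combinatorics from the Poisson weights.\<close>

definition gcp_mass :: "nat \<Rightarrow> (nat \<Rightarrow> nat \<Rightarrow> real) \<Rightarrow> nat \<Rightarrow> real"
  where "gcp_mass m f n = (\<Sum>x\<in>gcp_index_set m n. \<Prod>j=1..m. f j (x j))"

lemma gcp_mass_0: "gcp_mass 0 f n = (if n = 0 then 1 else 0)"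
  by (auto simp: gcp_mass_def gcp_index_set_def)

text \<open>Tuples are sorted by their last entry \<open>v\<close>, which uses up
  \<open>Suc m * v\<close> of the total. The result is a convolution of the form in
  \<open>prob_add_eq_sum_nat\<close> with \<open>c = Suc m\<close>.\<close>

lemma gcp_mass_Suc:
  "gcp_mass (Suc m) f n = (\<Sum>v\<in>{0..n div Suc m}. gcp_mass m f (n - Suc m * v) * f (Suc m) v)"
proof -
  have le: "Suc m * v \<le> n" if "v \<le> n div Suc m" for v
    using that by (simp only: less_eq_div_iff_mult_less_eq zero_less_Suc mult.commute)
  have upd: "(\<Sum>j=1..m. j * (x(Suc m := v)) j) = (\<Sum>j=1..m. j * x j)"
    for x :: "nat \<Rightarrow> nat" and v by (intro sum.cong) auto
  have "(\<Sum>v\<in>{0..n div Suc m}. gcp_mass m f (n - Suc m * v) * f (Suc m) v) =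
    (\<Sum>v\<in>{0..n div Suc m}. \<Sum>x\<in>gcp_index_set m (n - Suc m * v). (\<Prod>j=1..m. f j (x j)) * f (Suc m) v)"
    by (simp add: gcp_mass_def sum_distrib_right)
  also have "\<dots> = (\<Sum>(v, x)\<in>(SIGMA v:{0..n div Suc m}. gcp_index_set m (n - Suc m * v)). (\<Prod>j=1..m. f j (x j)) * f (Suc m) v)"
    by (rule sum.Sigma) (auto simp: gcp_index_set_finite)
  also have "\<dots> = (\<Sum>x\<in>gcp_index_set (Suc m) n. \<Prod>j=1..Suc m. f j (x j))"
  \<comment> \<open>Resetting the last entry to \<open>undefined\<close> makes the shortened tuple
    extensional on \<open>{1..m}\<close>, so the two maps are mutually inverse.\<close>
  proof (rule sum.reindex_bij_witness[where i="\<lambda>x. (x (Suc m), x(Suc m := undefined))"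
        and j="\<lambda>(v, x). x(Suc m := v)"])
    fix p assume p: "p \<in> (SIGMA v:{0..n div Suc m}. gcp_index_set m (n - Suc m * v))"
    obtain v x where vx: "p = (v, x)" by (cases p)
    with p have x: "v \<le> n div Suc m" "x \<in> extensional {1..m}" "(\<Sum>j=1..m. j * x j) = n - Suc m * v"
      by (auto simp: gcp_index_set_def PiE_iff)
    show "(\<lambda>x. (x (Suc m), x(Suc m := undefined))) ((\<lambda>(v, x). x(Suc m := v)) p) = p"
      using vx x(2) by (auto simp: fun_eq_iff extensional_def)
    show "(\<lambda>(v, x). x(Suc m := v)) p \<in> gcp_index_set (Suc m) n"
      using le[OF x(1)] x(2,3) vx upd[of x v]
      by (auto simp: gcp_index_set_def PiE_iff extensional_def)
    have "(\<Prod>j=1..m. f j ((x(Suc m := v)) j)) = (\<Prod>j=1..m. f j (x j))"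
      by (intro prod.cong) auto
    then show "(\<Prod>j=1..Suc m. f j (((\<lambda>(v, x). x(Suc m := v)) p) j)) =
        (case p of (v, x) \<Rightarrow> (\<Prod>j=1..m. f j (x j)) * f (Suc m) v)"
      using vx by simp
  next
    fix x assume x: "x \<in> gcp_index_set (Suc m) n"
    then have x': "(\<Sum>j=1..m. j * x j) + Suc m * x (Suc m) = n" "x \<in> extensional {1..Suc m}"
      by (auto simp: gcp_index_set_def PiE_iff)
    then have "Suc m * x (Suc m) \<le> n"
      by linarith
    then have "x (Suc m) \<le> n div Suc m"
      by (simp only: less_eq_div_iff_mult_less_eq zero_less_Suc mult.commute)
    with x' upd[of x undefined]
    show "(x (Suc m), x(Suc m := undefined)) \<in> (SIGMA v:{0..n div Suc m}. gcp_index_set m (n - Suc m * v))"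
      by (auto simp: gcp_index_set_def PiE_iff extensional_def le_Suc_eq)
  qed auto
  finally show ?thesis
    by (simp add: gcp_mass_def)
qed

lemma gcp_mass_at_0: "gcp_mass m f 0 = (\<Prod>j=1..m. f j 0)"
  by (induction m) (simp_all add: gcp_mass_0 gcp_mass_Suc)

subsection \<open>Pairs of independent counting processes\<close>

text \<open>Negative values carry no mass on either side, so the laws are compared at natural
  numbers only, where the convolution formulas apply.\<close>

lemma (in prob_space) distr_int_eq_iff:
  fixes X Y :: "'a \<Rightarrow> int"
  assumes "X \<in> measurable M (count_space UNIV)" "Y \<in> measurable M (count_space UNIV)"
    and nonneg: "\<And>\<omega>. \<omega> \<in> space M \<Longrightarrow> 0 \<le> X \<omega>" "\<And>\<omega>. \<omega> \<in> space M \<Longrightarrow> 0 \<le> Y \<omega>"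
  shows "distr M (count_space UNIV) X = distr M (count_space UNIV) Y \<longleftrightarrow>
    (\<forall>n::nat. prob {\<omega>\<in>space M. X \<omega> = int n} = prob {\<omega>\<in>space M. Y \<omega> = int n})"
proof -
  have "prob {\<omega>\<in>space M. W \<omega> = a} = 0" if "a < 0" "\<And>\<omega>. \<omega> \<in> space M \<Longrightarrow> 0 \<le> W \<omega>"
    for a and W :: "'a \<Rightarrow> int"
  proof -
    have "{\<omega>\<in>space M. W \<omega> = a} = {}"
      using that by fastforce
    then show ?thesis
      by (simp only: measure_empty)
  qed
  with nonneg have "prob {\<omega>\<in>space M. X \<omega> = a} = prob {\<omega>\<in>space M. Y \<omega> = a}" if "a < 0" for a
    using that by simp
  then have "(\<forall>n::nat. prob {\<omega>\<in>space M. X \<omega> = int n} = prob {\<omega>\<in>space M. Y \<omega> = int n}) \<Longrightarrow>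
      prob {\<omega>\<in>space M. X \<omega> = a} = prob {\<omega>\<in>space M. Y \<omega> = a}" for a
    by (cases "a < 0") (auto elim: nonneg_int_cases[of a] simp: not_less)
  then show ?thesis
    unfolding distr_count_space_eq_iff[OF assms(1,2)] by blast
qed

lemma multiparameter_counting_processD:
  assumes "multiparameter_counting_process P X"
  shows "0 \<le> t \<Longrightarrow> X t \<in> measurable P (count_space UNIV)"
    and "\<omega> \<in> space P \<Longrightarrow> X 0 \<omega> = 0"
    and "0 \<le> t \<Longrightarrow> \<omega> \<in> space P \<Longrightarrow> 0 \<le> X t \<omega>"
    and "0 \<le> s \<Longrightarrow> s \<le> t \<Longrightarrow> \<omega> \<in> space P \<Longrightarrow> X s \<omega> \<le> X t \<omega>"
  using assms by (auto simp: multiparameter_counting_process_def)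

lemma increasing_times_nonneg:
  fixes t :: "nat \<Rightarrow> real ^ 'd"
  assumes "t 0 = 0" and "\<And>i. i < n \<Longrightarrow> strictly_below (t i) (t (Suc i))"
  shows "i \<le> n \<Longrightarrow> 0 \<le> t i" and "i < n \<Longrightarrow> t i \<le> t (Suc i)"
proof -
  have le: "t i \<le> t (Suc i)" if "i < n" for i
    using assms(2)[OF that] by (auto simp: strictly_below_def less_eq_vec_def less_imp_le)
  then show "i < n \<Longrightarrow> t i \<le> t (Suc i)" .
  show "i \<le> n \<Longrightarrow> 0 \<le> t i"
  proof (induction i)
    case (Suc i)
    then show ?case using le[of i] by (auto intro: order_trans)
  qed (simp add: assms(1))
qed

text \<open>One step of the induction: \<open>X\<close> is the weighted sum so far, \<open>Y\<close>
  the next process and \<open>c\<close> its weight. Independence is required of whole paths, so that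
  values and increments inherit it by composition with measurable maps.\<close>

locale independent_counting_pair = prob_space P for P :: "'w measure" +
  fixes X Y :: "real ^ 'd \<Rightarrow> 'w \<Rightarrow> int" and c :: nat
  assumes counting_X: "multiparameter_counting_process P X"
    and counting_Y: "multiparameter_counting_process P Y"
    and indep_paths: "indep_var (Pi\<^sub>M {0..} (\<lambda>_. count_space UNIV)) (\<lambda>\<omega>. \<lambda>t\<in>{0..}. X t \<omega>)
      (Pi\<^sub>M {0..} (\<lambda>_. count_space UNIV)) (\<lambda>\<omega>. \<lambda>t\<in>{0..}. Y t \<omega>)"
    and c_pos: "c > 0"
begin

lemmas X = multiparameter_counting_processD[OF counting_X]
lemmas Y = multiparameter_counting_processD[OF counting_Y]

abbreviation Z :: "real ^ 'd \<Rightarrow> 'w \<Rightarrow> int"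
  where "Z \<equiv> \<lambda>t \<omega>. X t \<omega> + int c * Y t \<omega>"

lemma counting_Z: "multiparameter_counting_process P Z"
  unfolding multiparameter_counting_process_def
proof (intro conjI allI impI ballI)
  fix t :: "real ^ 'd" assume "0 \<le> t"
  then show "Z t \<in> measurable P (count_space UNIV)"
    by (intro measurable_count_space_binop[OF X(1) Y(1)])
qed (use X Y in \<open>auto intro!: add_mono mult_left_mono\<close>)

lemmas Z = multiparameter_counting_processD[OF counting_Z]

section \<open>Independence of values and increments, inherited from the paths\<close>

lemma indep_value:
  assumes "0 \<le> t"
  shows "indep_var (count_space UNIV) (X t) (count_space UNIV) (Y t)"
proof -
  have "(\<lambda>p. p t) \<in> measurable (Pi\<^sub>M {0..} (\<lambda>_. count_space (UNIV :: int set))) (count_space UNIV)"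
    using assms by (intro measurable_component_singleton) auto
  from indep_var_compose[OF indep_paths this this] show ?thesis
    using assms by (simp add: o_def)
qed

lemma indep_increment_vectors:
  assumes "\<And>i. i \<in> I \<Longrightarrow> 0 \<le> s i" "\<And>i. i \<in> I \<Longrightarrow> 0 \<le> t i"
  shows "indep_var (Pi\<^sub>M I (\<lambda>_. count_space UNIV)) (\<lambda>\<omega>. \<lambda>i\<in>I. X (t i) \<omega> - X (s i) \<omega>)
    (Pi\<^sub>M I (\<lambda>_. count_space UNIV)) (\<lambda>\<omega>. \<lambda>i\<in>I. Y (t i) \<omega> - Y (s i) \<omega>)"
proof -
  have "(\<lambda>p. \<lambda>i\<in>I. p (t i) - p (s i)) \<in>
    measurable (Pi\<^sub>M {0..} (\<lambda>_. count_space (UNIV :: int set))) (Pi\<^sub>M I (\<lambda>_. count_space UNIV))"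
  proof (rule measurable_restrict)
    fix i assume "i \<in> I"
    then have "(\<lambda>p. p (t i)) \<in> measurable (Pi\<^sub>M {0..} (\<lambda>_. count_space (UNIV :: int set))) (count_space UNIV)"
      "(\<lambda>p. p (s i)) \<in> measurable (Pi\<^sub>M {0..} (\<lambda>_. count_space (UNIV :: int set))) (count_space UNIV)"
      using assms by (auto intro!: measurable_component_singleton)
    then show "(\<lambda>p. p (t i) - p (s i)) \<in> measurable (Pi\<^sub>M {0..} (\<lambda>_. count_space (UNIV :: int set))) (count_space UNIV)"
      by (rule measurable_count_space_binop)
  qed
  from indep_var_compose[OF indep_paths this this] show ?thesis
    using assms by (simp add: o_def cong: restrict_cong)
qed

lemma indep_increment:
  assumes "0 \<le> s" "0 \<le> t"
  shows "indep_var (count_space UNIV) (\<lambda>\<omega>. X t \<omega> - X s \<omega>) (count_space UNIV) (\<lambda>\<omega>. Y t \<omega> - Y s \<omega>)"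
proof -
  \<comment> \<open>A single increment is a vector of increments over the one-point index type
    \<open>unit\<close>.\<close>
  have "(\<lambda>p. p ()) \<in> measurable (Pi\<^sub>M UNIV (\<lambda>_. count_space (UNIV :: int set))) (count_space UNIV)"
    by (intro measurable_component_singleton) auto
  from indep_var_compose[OF indep_increment_vectors[of "UNIV :: unit set" "\<lambda>_. s" "\<lambda>_. t"] this this]
  show ?thesis
    using assms by (simp add: o_def)
qed

lemma Z_increment: "Z t \<omega> - Z s \<omega> = (X t \<omega> - X s \<omega>) + int c * (Y t \<omega> - Y s \<omega>)"
  by (simp add: algebra_simps)

lemma prob_Z:
  assumes "0 \<le> t"
  shows "prob {\<omega>\<in>space P. Z t \<omega> = int n} =
    (\<Sum>v\<in>{0..n div c}. prob {\<omega>\<in>space P. X t \<omega> = int (n - c * v)} * prob {\<omega>\<in>space P. Y t \<omega> = int v})"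
  by (rule prob_add_eq_sum_nat[OF indep_value[OF assms] X(3)[OF assms] Y(3)[OF assms] c_pos])

text \<open>The candidate \<open>r\<close> is arbitrary because two are needed: the law of an
  increment of \<open>Y\<close>, for stationarity, and the Poisson masses.\<close>

lemma prob_Y_eqI:
  assumes "0 \<le> t" and "prob {\<omega>\<in>space P. X t \<omega> = 0} \<noteq> 0"
    and "\<And>n. prob {\<omega>\<in>space P. Z t \<omega> = int n} =
      (\<Sum>v\<in>{0..n div c}. prob {\<omega>\<in>space P. X t \<omega> = int (n - c * v)} * r v)"
  shows "prob {\<omega>\<in>space P. Y t \<omega> = int n} = r n"
  by (rule prob_cancel_summand[OF indep_value[OF assms(1)] X(3)[OF assms(1)] Y(3)[OF assms(1)] c_pos assms(2,3)])

section \<open>Transfer of stationary and independent increments between \<open>Y\<close> and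
  \<open>Z\<close>\<close>

lemma stationary_increments_iff:
  assumes "multiparameter_counting_process P W"
  shows "stationary_increments P W \<longleftrightarrow> (\<forall>s\<ge>0. \<forall>t\<ge>s. \<forall>n::nat.
    prob {\<omega>\<in>space P. W t \<omega> - W s \<omega> = int n} = prob {\<omega>\<in>space P. W (t - s) \<omega> = int n})"
proof -
  note W = multiparameter_counting_processD[OF assms]
  have "distr P (count_space UNIV) (\<lambda>\<omega>. W t \<omega> - W s \<omega>) = distr P (count_space UNIV) (W (t - s)) \<longleftrightarrow>
    (\<forall>n::nat. prob {\<omega>\<in>space P. W t \<omega> - W s \<omega> = int n} = prob {\<omega>\<in>space P. W (t - s) \<omega> = int n})"
    if st: "0 \<le> s" "s \<le> t" for s t
  proof (rule distr_int_eq_iff)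
    have "W s \<in> measurable P (count_space UNIV)" "W t \<in> measurable P (count_space UNIV)"
      using W(1)[of s] W(1)[of t] st by (auto intro: order_trans)
    then show "(\<lambda>\<omega>. W t \<omega> - W s \<omega>) \<in> measurable P (count_space UNIV)"
      by (rule measurable_count_space_binop)
  qed (use W st in auto)
  then show ?thesis
    unfolding stationary_increments_def by blast
qed

text \<open>By stationarity of \<open>X\<close>, the laws of \<open>Z t - Z s\<close> and of
  \<open>Z (t - s)\<close> are convolutions of one and the same law, that of
  \<open>X (t - s)\<close>, with the laws of \<open>Y t - Y s\<close> and of
  \<open>Y (t - s)\<close>. Equality thus passes from \<open>Y\<close> to \<open>Z\<close>, and back
  by cancellation.\<close>

lemma
  assumes X_stationary: "stationary_increments P X"
  shows stationary_increments_Z: "stationary_increments P Y \<Longrightarrow> stationary_increments P Z"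
    and stationary_increments_Y: "stationary_increments P Z \<Longrightarrow>
      (\<And>t. 0 \<le> t \<Longrightarrow> prob {\<omega>\<in>space P. X t \<omega> = 0} \<noteq> 0) \<Longrightarrow> stationary_increments P Y"
proof -
  have nonneg: "0 \<le> X t \<omega> - X s \<omega>" "0 \<le> Y t \<omega> - Y s \<omega>" if "0 \<le> s" "s \<le> t" "\<omega> \<in> space P" for s t \<omega>
    using X(4)[OF that] Y(4)[OF that] by simp_all
  have X_law: "prob {\<omega>\<in>space P. X t \<omega> - X s \<omega> = int n} = prob {\<omega>\<in>space P. X (t - s) \<omega> = int n}"
    if "0 \<le> s" "s \<le> t" for s t n
    using X_stationary that unfolding stationary_increments_iff[OF counting_X] by blast
  have Z_law: "prob {\<omega>\<in>space P. Z t \<omega> - Z s \<omega> = int n} =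
    (\<Sum>v\<in>{0..n div c}. prob {\<omega>\<in>space P. X (t - s) \<omega> = int (n - c * v)} *
      prob {\<omega>\<in>space P. Y t \<omega> - Y s \<omega> = int v})" if st: "0 \<le> s" "s \<le> t" for s t n
    unfolding Z_increment X_law[OF st, symmetric]
    by (intro prob_add_eq_sum_nat indep_increment nonneg c_pos st order_trans[OF st])
  show "stationary_increments P Z" if "stationary_increments P Y"
    unfolding stationary_increments_iff[OF counting_Z]
  proof (intro allI impI)
    fix s t :: "real ^ 'd" and n :: nat assume st: "0 \<le> s" "s \<le> t"
    show "prob {\<omega>\<in>space P. Z t \<omega> - Z s \<omega> = int n} = prob {\<omega>\<in>space P. Z (t - s) \<omega> = int n}"
      using that st unfolding Z_law[OF st] stationary_increments_iff[OF counting_Y]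
      by (subst prob_Z) auto
  qed
  show "stationary_increments P Y" if Z_stationary: "stationary_increments P Z"
    and X0: "\<And>t. 0 \<le> t \<Longrightarrow> prob {\<omega>\<in>space P. X t \<omega> = 0} \<noteq> 0"
    unfolding stationary_increments_iff[OF counting_Y]
  proof (intro allI impI)
    fix s t :: "real ^ 'd" and n :: nat assume st: "0 \<le> s" "s \<le> t"
    show "prob {\<omega>\<in>space P. Y t \<omega> - Y s \<omega> = int n} = prob {\<omega>\<in>space P. Y (t - s) \<omega> = int n}"
    \<comment> \<open>Cancellation at time \<open>t - s\<close>, with the law of the increment of
      \<open>Y\<close> as the candidate.\<close>
    proof (rule sym, rule prob_Y_eqI)
      fix n
      have "prob {\<omega>\<in>space P. Z (t - s) \<omega> = int n} = prob {\<omega>\<in>space P. Z t \<omega> - Z s \<omega> = int n}"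
        using Z_stationary st unfolding stationary_increments_iff[OF counting_Z] by simp
      then show "prob {\<omega>\<in>space P. Z (t - s) \<omega> = int n} = (\<Sum>v\<in>{0..n div c}.
          prob {\<omega>\<in>space P. X (t - s) \<omega> = int (n - c * v)} * prob {\<omega>\<in>space P. Y t \<omega> - Y s \<omega> = int v})"
        unfolding Z_law[OF st] .
    qed (use X0 st in auto)
  qed
qed

text \<open>The increments along a chain of times form two independent vectors, to which the
  addition and cancellation of independent summands apply. Cancellation needs increments of
  \<open>X\<close> that vanish with positive probability; stationarity reduces this to the values of
  \<open>X\<close>.\<close>

lemma
  assumes X_independent: "independent_increments P X"
  shows independent_increments_Z: "independent_increments P Y \<Longrightarrow> independent_increments P Z"
    and independent_increments_Y: "independent_increments P Z \<Longrightarrow> stationary_increments P X \<Longrightarrow>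
      (\<And>t. 0 \<le> t \<Longrightarrow> prob {\<omega>\<in>space P. X t \<omega> = 0} \<noteq> 0) \<Longrightarrow> independent_increments P Y"
proof -
  have X_indep: "indep_vars (\<lambda>_. count_space UNIV) (\<lambda>i \<omega>. X (t (Suc i)) \<omega> - X (t i) \<omega>) {..<n}"
    if "t 0 = 0" "\<forall>i<n. strictly_below (t i) (t (Suc i))" for t :: "nat \<Rightarrow> real ^ 'd" and n :: nat
    using X_independent that by (auto simp: independent_increments_def)
  have vec: "indep_var (Pi\<^sub>M {..<n} (\<lambda>_. count_space UNIV)) (\<lambda>\<omega>. \<lambda>i\<in>{..<n}. X (t (Suc i)) \<omega> - X (t i) \<omega>)
    (Pi\<^sub>M {..<n} (\<lambda>_. count_space UNIV)) (\<lambda>\<omega>. \<lambda>i\<in>{..<n}. Y (t (Suc i)) \<omega> - Y (t i) \<omega>)"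
    and nonneg: "\<And>i \<omega>. i \<in> {..<n} \<Longrightarrow> \<omega> \<in> space P \<Longrightarrow> 0 \<le> X (t (Suc i)) \<omega> - X (t i) \<omega>"
      "\<And>i \<omega>. i \<in> {..<n} \<Longrightarrow> \<omega> \<in> space P \<Longrightarrow> 0 \<le> Y (t (Suc i)) \<omega> - Y (t i) \<omega>"
    if "t 0 = 0" "\<forall>i<n. strictly_below (t i) (t (Suc i))" for t :: "nat \<Rightarrow> real ^ 'd" and n :: nat
    using increasing_times_nonneg[of t n] that
    by (intro indep_increment_vectors X(4) Y(4) diff_ge_0_iff_ge[THEN iffD2]; simp)+
  note args = finite_lessThan vec nonneg iffD2[OF of_nat_0_less_iff c_pos] X_indep
  show "independent_increments P Z" if "independent_increments P Y"
    unfolding independent_increments_def Z_increment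
  proof (intro allI impI)
    fix n :: nat and t :: "nat \<Rightarrow> real ^ 'd"
    assume t: "t 0 = 0" "\<forall>i<n. strictly_below (t i) (t (Suc i))"
    show "indep_vars (\<lambda>_. count_space UNIV)
      (\<lambda>i \<omega>. (X (t (Suc i)) \<omega> - X (t i) \<omega>) + int c * (Y (t (Suc i)) \<omega> - Y (t i) \<omega>)) {..<n}"
      by (rule indep_vars_add_independent[OF args]) (use that t in \<open>auto simp: independent_increments_def\<close>)
  qed
  show "independent_increments P Y" if "independent_increments P Z" "stationary_increments P X"
    and X0: "\<And>t. 0 \<le> t \<Longrightarrow> prob {\<omega>\<in>space P. X t \<omega> = 0} \<noteq> 0"
    unfolding independent_increments_def
  proof (intro allI impI)
    fix n :: nat and t :: "nat \<Rightarrow> real ^ 'd"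
    assume t: "t 0 = 0" "\<forall>i<n. strictly_below (t i) (t (Suc i))"
    show "indep_vars (\<lambda>_. count_space UNIV) (\<lambda>i \<omega>. Y (t (Suc i)) \<omega> - Y (t i) \<omega>) {..<n}"
    proof (rule indep_vars_cancel_summand[OF args])
      show "indep_vars (\<lambda>_. count_space UNIV)
        (\<lambda>i \<omega>. (X (t (Suc i)) \<omega> - X (t i) \<omega>) + int c * (Y (t (Suc i)) \<omega> - Y (t i) \<omega>)) {..<n}"
        unfolding Z_increment[symmetric] using that(1) t by (auto simp: independent_increments_def)
      fix i assume "i \<in> {..<n}"
      then have st: "0 \<le> t i" "t i \<le> t (Suc i)"
        using increasing_times_nonneg[of t n i] t by auto
      have "prob {\<omega>\<in>space P. X (t (Suc i)) \<omega> - X (t i) \<omega> = int 0} =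
          prob {\<omega>\<in>space P. X (t (Suc i) - t i) \<omega> = int 0}"
        using that(2) st unfolding stationary_increments_iff[OF counting_X] by blast
      with X0[of "t (Suc i) - t i"] st
      show "prob {\<omega>\<in>space P. X (t (Suc i)) \<omega> - X (t i) \<omega> = 0} \<noteq> 0"
        by simp
    qed (use t in auto)
  qed
qed

end

subsection \<open>The induction on the number of processes\<close>

text \<open>
  Unlike \<open>multiparameter_GCP\<close>, this admits \<open>m = 0\<close>, so that the zero process can serve as
  the start of the induction.
\<close>

definition gcp_like ::
    "'w measure \<Rightarrow> nat \<Rightarrow> (nat \<Rightarrow> real ^ 'd) \<Rightarrow> (real ^ 'd \<Rightarrow> 'w \<Rightarrow> int) \<Rightarrow> bool"
  where "gcp_like P m \<Lambda> X \<longleftrightarrow>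
    multiparameter_counting_process P X \<and> independent_increments P X \<and> stationary_increments P X \<and>
    (\<forall>t\<ge>0. \<forall>n::nat. measure P {\<omega>\<in>space P. X t \<omega> = int n} =
      gcp_mass m (\<lambda>j x. (\<Lambda> j \<bullet> t) ^ x / fact x * exp (- (\<Lambda> j \<bullet> t))) n)"

lemma multiparameter_GCP_iff_gcp_like:
  assumes "m \<ge> 1" "\<And>j. j \<in> {1..m} \<Longrightarrow> strictly_below 0 (\<Lambda> j)"
  shows "multiparameter_GCP P m \<Lambda> X \<longleftrightarrow> gcp_like P m \<Lambda> X"
  using assms multiparameter_counting_processD(2)[of P X]
  unfolding multiparameter_GCP_def gcp_like_def gcp_mass_def by blast

lemma (in prob_space) gcp_like_0: "gcp_like M 0 \<Lambda> (\<lambda>_ _. 0)"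
  unfolding gcp_like_def
proof (intro conjI)
  show "multiparameter_counting_process M (\<lambda>_ _. 0)"
    by (simp add: multiparameter_counting_process_def)
  show "independent_increments M (\<lambda>_ _. 0)"
    unfolding independent_increments_def
  proof (intro allI impI)
    fix n :: nat
    \<comment> \<open>All events here are constant, so the joint probability and the product are
      both the indicator of \<open>a\<close> vanishing below \<open>n\<close>.\<close>
    have const: "prob {\<omega>\<in>space M. Q} = (if Q then 1 else 0)" for Q
      by (simp add: prob_space)
    have "prob {\<omega>\<in>space M. \<forall>i\<in>{..<n}. (0::int) - 0 = a i} = (\<Prod>i<n. prob {\<omega>\<in>space M. (0::int) - 0 = a i})"
      for a :: "nat \<Rightarrow> int"
      unfolding const by (auto simp: prod_zero_iff)
    then show "indep_vars (\<lambda>_. count_space UNIV) (\<lambda>i \<omega>. (0::int) - 0) {..<n}"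
      by (subst indep_vars_iff_prob_eq_prod) simp_all
  qed
  show "stationary_increments M (\<lambda>_ _. 0)"
    by (simp add: stationary_increments_def)
qed (simp add: gcp_mass_0 prob_space)

text \<open>Independence and stationarity of increments transfer separately between \<open>Y\<close>
  and \<open>Z\<close>. At each time the one-dimensional laws correspond because the GCP masses
  satisfy the same convolution recursion, with the Poisson masses of rate
  \<open>\<Lambda> (Suc m)\<close> in the place of the law of \<open>Y\<close>.\<close>

lemma (in independent_counting_pair) gcp_like_step:
  assumes X: "gcp_like P m \<Lambda> X" and c: "c = Suc m" and pos: "strictly_below 0 (\<Lambda> (Suc m))"
  shows "gcp_like P (Suc m) \<Lambda> Z \<longleftrightarrow> multiparameter_Poisson_process P (\<Lambda> (Suc m)) Y"
proof -
  define f :: "real ^ 'd \<Rightarrow> nat \<Rightarrow> nat \<Rightarrow> real"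
    where "f = (\<lambda>t j x. (\<Lambda> j \<bullet> t) ^ x / fact x * exp (- (\<Lambda> j \<bullet> t)))"
  have X': "independent_increments P X" "stationary_increments P X"
    and X_law: "\<And>t n. 0 \<le> t \<Longrightarrow> prob {\<omega>\<in>space P. X t \<omega> = int n} = gcp_mass m (f t) n"
    using X by (simp_all add: gcp_like_def f_def)
  \<comment> \<open>Only the zero tuple contributes, and it leaves a product of
    exponentials.\<close>
  have X0: "prob {\<omega>\<in>space P. X t \<omega> = 0} \<noteq> 0" if "0 \<le> t" for t
    using X_law[OF that, of 0] by (simp add: gcp_mass_at_0 f_def)
  have mass_Suc: "gcp_mass (Suc m) (f t) n =
      (\<Sum>v\<in>{0..n div c}. gcp_mass m (f t) (n - c * v) * f t (Suc m) v)" for t n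
    unfolding c by (rule gcp_mass_Suc)
  have "independent_increments P Z \<longleftrightarrow> independent_increments P Y"
    using independent_increments_Z independent_increments_Y X' X0 by blast
  moreover have "stationary_increments P Z \<longleftrightarrow> stationary_increments P Y"
    using stationary_increments_Z stationary_increments_Y X' X0 by blast
  moreover have "(\<forall>n. prob {\<omega>\<in>space P. Z t \<omega> = int n} = gcp_mass (Suc m) (f t) n) \<longleftrightarrow>
      (\<forall>n. prob {\<omega>\<in>space P. Y t \<omega> = int n} = f t (Suc m) n)" if t: "0 \<le> t" for t
  proof
    assume Z_law: "\<forall>n. prob {\<omega>\<in>space P. Z t \<omega> = int n} = gcp_mass (Suc m) (f t) n"
    show "\<forall>n. prob {\<omega>\<in>space P. Y t \<omega> = int n} = f t (Suc m) n"
      by (intro allI prob_Y_eqI[OF t X0[OF t]]) (simp only: Z_law mass_Suc X_law[OF t])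
  next
    assume "\<forall>n. prob {\<omega>\<in>space P. Y t \<omega> = int n} = f t (Suc m) n"
    then show "\<forall>n. prob {\<omega>\<in>space P. Z t \<omega> = int n} = gcp_mass (Suc m) (f t) n"
      by (simp only: mass_Suc prob_Z[OF t] X_law[OF t] simp_thms)
  qed
  then have "(\<forall>t\<ge>0. \<forall>n. prob {\<omega>\<in>space P. Z t \<omega> = int n} = gcp_mass (Suc m) (f t) n) \<longleftrightarrow>
      (\<forall>t\<ge>0. \<forall>n. prob {\<omega>\<in>space P. Y t \<omega> = int n} = f t (Suc m) n)"
    by blast
  ultimately show ?thesis
    using pos counting_Z counting_Y Y(2)
    unfolding gcp_like_def multiparameter_Poisson_process_def f_def by blast
qed

text \<open>The index blocks \<open>{1..l}\<close> and \<open>{Suc l}\<close> are disjoint, so the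
  two families of paths are independent. The weighted sum is a measurable function of the first
  family, and the next process is a projection of the second.\<close>

lemma (in prob_space) indep_paths_weighted_sum:
  fixes N :: "nat \<Rightarrow> real ^ 'd \<Rightarrow> 'a \<Rightarrow> int"
  assumes ind: "independent_processes M N {1..k}" and l: "l < k"
  shows "indep_var (Pi\<^sub>M {0..} (\<lambda>_. count_space UNIV)) (\<lambda>\<omega>. \<lambda>t\<in>{0..}. \<Sum>j=1..l. int j * N j t \<omega>)
    (Pi\<^sub>M {0..} (\<lambda>_. count_space UNIV)) (\<lambda>\<omega>. \<lambda>t\<in>{0..}. N (Suc l) t \<omega>)"
proof -
  let ?paths = "Pi\<^sub>M {0 :: real ^ 'd..} (\<lambda>_. count_space (UNIV :: int set))"
  let ?f = "\<lambda>p. \<lambda>t\<in>{0 :: real ^ 'd..}. \<Sum>j=1..l. int j * p j t"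
  have "?f \<in> measurable (Pi\<^sub>M {1..l} (\<lambda>_. ?paths)) ?paths"
  proof (rule measurable_restrict)
    fix t :: "real ^ 'd" assume t: "t \<in> {0..}"
    have "(\<lambda>p. \<lambda>j\<in>{1..l}. p j t) \<in> measurable (Pi\<^sub>M {1..l} (\<lambda>_. ?paths)) (Pi\<^sub>M {1..l} (\<lambda>_. count_space UNIV))"
    proof (rule measurable_restrict)
      fix j assume "j \<in> {1..l}"
      then have "(\<lambda>p. p j) \<in> measurable (Pi\<^sub>M {1..l} (\<lambda>_. ?paths)) ?paths"
        by (rule measurable_component_singleton)
      moreover have "(\<lambda>p. p t) \<in> measurable ?paths (count_space UNIV)"
        using t by (rule measurable_component_singleton)
      ultimately show "(\<lambda>p. p j t) \<in> measurable (Pi\<^sub>M {1..l} (\<lambda>_. ?paths)) (count_space UNIV)"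
        by (rule measurable_compose)
    qed
    \<comment> \<open>A finite product of countable discrete spaces is discrete, so every map on it
      is measurable.\<close>
    moreover have "(\<lambda>q. \<Sum>j=1..l. int j * q j) \<in> measurable (Pi\<^sub>M {1..l} (\<lambda>_. count_space UNIV)) (count_space UNIV)"
      by (subst count_space_PiM_finite) auto
    ultimately have "(\<lambda>p. \<Sum>j=1..l. int j * (\<lambda>j\<in>{1..l}. p j t) j) \<in> measurable (Pi\<^sub>M {1..l} (\<lambda>_. ?paths)) (count_space UNIV)"
      by (rule measurable_compose)
    moreover have "(\<lambda>p. \<Sum>j=1..l. int j * (\<lambda>j\<in>{1..l}. p j t) j) = (\<lambda>p. \<Sum>j=1..l. int j * p j t)"
      by (intro ext sum.cong) simp_all
    ultimately show "(\<lambda>p. \<Sum>j=1..l. int j * p j t) \<in> measurable (Pi\<^sub>M {1..l} (\<lambda>_. ?paths)) (count_space UNIV)"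
      by (simp only:)
  qed
  moreover have "(\<lambda>p. p (Suc l)) \<in> measurable (Pi\<^sub>M {Suc l} (\<lambda>_. ?paths)) ?paths"
    by (rule measurable_component_singleton) simp
  moreover have "indep_var (Pi\<^sub>M {1..l} (\<lambda>_. ?paths)) (\<lambda>\<omega>. \<lambda>j\<in>{1..l}. \<lambda>t\<in>{0..}. N j t \<omega>)
      (Pi\<^sub>M {Suc l} (\<lambda>_. ?paths)) (\<lambda>\<omega>. \<lambda>j\<in>{Suc l}. \<lambda>t\<in>{0..}. N j t \<omega>)"
    using l by (intro indep_var_restrict[OF ind[unfolded independent_processes_def]]) auto
  ultimately have "indep_var ?paths (?f \<circ> (\<lambda>\<omega>. \<lambda>j\<in>{1..l}. \<lambda>t\<in>{0..}. N j t \<omega>))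
      ?paths ((\<lambda>p. p (Suc l)) \<circ> (\<lambda>\<omega>. \<lambda>j\<in>{Suc l}. \<lambda>t\<in>{0..}. N j t \<omega>))"
    by (intro indep_var_compose)
  moreover have "?f \<circ> (\<lambda>\<omega>. \<lambda>j\<in>{1..l}. \<lambda>t\<in>{0..}. N j t \<omega>) = (\<lambda>\<omega>. \<lambda>t\<in>{0..}. \<Sum>j=1..l. int j * N j t \<omega>)"
    by (auto simp: fun_eq_iff restrict_def intro!: sum.cong)
  moreover have "(\<lambda>p. p (Suc l)) \<circ> (\<lambda>\<omega>. \<lambda>j\<in>{Suc l}. \<lambda>t\<in>{0..}. N j t \<omega>) = (\<lambda>\<omega>. \<lambda>t\<in>{0..}. N (Suc l) t \<omega>)"
    by (simp add: fun_eq_iff)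
  ultimately show ?thesis
    by simp
qed

theorem theorem2p1:
  fixes P :: "'w measure"
    and k :: nat
    and \<Lambda> :: "nat \<Rightarrow> real ^ 'd"
    and N :: "nat \<Rightarrow> real ^ 'd \<Rightarrow> 'w \<Rightarrow> int"
  assumes "prob_space P"
    and "k \<ge> 1"
    and "\<And>j. j \<in> {1..k} \<Longrightarrow> 0 \<prec> \<Lambda> j"
    and "\<And>j. j \<in> {1..k} \<Longrightarrow> multiparameter_counting_process P (N j)"
    and "independent_processes P N {1..k}"
  shows "(\<forall>l\<in>{1..k}. multiparameter_GCP P l \<Lambda> (\<lambda>t \<omega>. \<Sum>j=1..l. int j * N j t \<omega>)) \<longleftrightarrow>
         (\<forall>j\<in>{1..k}. multiparameter_Poisson_process P (\<Lambda> j) (N j))"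
proof -
  interpret prob_space P by fact
  let ?M = "\<lambda>l t \<omega>. \<Sum>j=1..l. int j * N j t \<omega>"
  have base: "gcp_like P 0 \<Lambda> (?M 0)"
    using gcp_like_0[of \<Lambda>] by simp
  have step: "gcp_like P (Suc l) \<Lambda> (?M (Suc l)) \<longleftrightarrow> multiparameter_Poisson_process P (\<Lambda> (Suc l)) (N (Suc l))"
    if l: "l < k" and M: "gcp_like P l \<Lambda> (?M l)" for l
  proof -
    interpret independent_counting_pair P "?M l" "N (Suc l)" "Suc l"
    proof unfold_locales
      show "multiparameter_counting_process P (?M l)"
        using M by (simp add: gcp_like_def)
    qed (use assms(4) l indep_paths_weighted_sum[OF assms(5) l] in auto)
    \<comment> \<open>Splitting off the last summand identifies \<open>?M (Suc l)\<close> with the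
      sum \<open>Z\<close> of the pair.\<close>
    show ?thesis
      using gcp_like_step[OF M refl] assms(3)[of "Suc l"] l by simp
  qed
  have GCP_iff: "multiparameter_GCP P l \<Lambda> (?M l) \<longleftrightarrow> gcp_like P l \<Lambda> (?M l)" if "l \<in> {1..k}" for l
    using that assms(3) by (intro multiparameter_GCP_iff_gcp_like) auto
  show ?thesis
  proof (intro iffI ballI)
    fix j assume GCP: "\<forall>l\<in>{1..k}. multiparameter_GCP P l \<Lambda> (?M l)" and j: "j \<in> {1..k}"
    then obtain l where l: "j = Suc l" "l < k"
      by (cases j) auto
    \<comment> \<open>Here every partial sum is a GCP by assumption, with the zero process added at
      \<open>i = 0\<close>; a single instance of \<open>step\<close> then yields the Poisson
      property.\<close>
    have "gcp_like P i \<Lambda> (?M i)" if "i \<le> k" for i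
    proof (cases "i = 0")
      case False
      with GCP GCP_iff[of i] that show ?thesis
        by auto
    qed (simp only: base)
    from step[OF l(2) this] this[of "Suc l"] l show "multiparameter_Poisson_process P (\<Lambda> j) (N j)"
      by (simp del: sum.cl_ivl_Suc)
  next
    fix l assume Poisson: "\<forall>j\<in>{1..k}. multiparameter_Poisson_process P (\<Lambda> j) (N j)" and l: "l \<in> {1..k}"
    \<comment> \<open>This direction is a genuine induction, since \<open>step\<close> presupposes
      the GCP property of the preceding partial sum.\<close>
    have "gcp_like P i \<Lambda> (?M i)" if "i \<le> k" for i
      using that
    proof (induction i)
      case (Suc i)
      then show ?case
        using step[of i] Poisson by (simp del: sum.cl_ivl_Suc)
    qed (simp only: base)
    with l GCP_iff[OF l] show "multiparameter_GCP P l \<Lambda> (?M l)"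
      by simp
  qed
qed

end
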